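(* For a Banach lattice $E$ the following statements are equivalent: (1) The identity operator $\mathrm{Id}_{E'} : E' \to E'$ is order L-weakly compact. (2) The norm of $E'$ is order continuous. (3) $f_n(x_n) \to 0$ for every order bounded sequence $(f_n)$ of $E'$ and every disjoint sequence $(x_n)$ of $B_E$. (4) The identity operator $\mathrm{Id}_E : E \to E$ is order M-weakly compact.
   Context: All Banach lattices are real; "operator" means bounded linear map; $G'$ denotes the topological dual (a Banach lattice when $G$ is one), and $B_G$ the closed unit ball of $G$. A nonempty bounded subset $A$ of a Banach lattice $G$ is L-weakly compact if $\lim\|x_n\|=0$ for every disjoint sequence $(x_n)$ in the solid hull of $A$. An operator $T : G \to H$ between Banach lattices is order L-weakly compact if $T[0,x]$ is an L-weakly compact subset of $H$ for each $x\in G^+$. An operator $T : G \to H$ between Banach lattices is order M-weakly compact if $f_n(T(x_n))\to 0$ for every disjoint sequence $(x_n)$ in $B_G$ and every order bounded sequence $(f_n)$ of $H'$. *)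

theory Defs
  imports "HOL-Analysis.Analysis" "HOL-Library.Lattice_Algebras"
begin

section \<open>Banach lattices\<close>

text \<open>The modulus is fixed to be the lattice one, \<open>\<bar>x\<bar> = sup x (- x)\<close>, by the
  superclass \<^class>\<open>lattice_ab_group_add_abs\<close>.\<close>

class banach_lattice = banach + ordered_real_vector + lattice_ab_group_add_abs +
  assumes norm_mono: "\<bar>x\<bar> \<le> \<bar>y\<bar> \<Longrightarrow> norm x \<le> norm y"

instance real :: banach_lattice
  by standard simp

lemma norm_mono_pos:
  fixes x y :: "'a::banach_lattice"
  assumes "0 \<le> x" "x \<le> y"
  shows "norm x \<le> norm y"
  using assms by (intro norm_mono) (simp add: order_trans[OF assms])

lemma norm_abs_eq [simp]: "norm \<bar>x\<bar> = norm (x::'a::banach_lattice)"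
  by (rule antisym; rule norm_mono; simp)


section \<open>The dual Banach lattice\<close>

text \<open>The topological dual is a copy of \<^typ>\<open>'a \<Rightarrow>\<^sub>L real\<close>; a separate type is needed only
  because the lattice instance cannot be given for \<open>\<Rightarrow>\<^sub>L\<close> with one particular codomain.
  Norm and linear structure are transported, and functionals are ordered by their values
  on the positive cone.\<close>

typedef (overloaded) 'a dual = "UNIV :: ('a::real_normed_vector \<Rightarrow>\<^sub>L real) set"
  morphisms blinfun_of_dual dual_of_blinfun ..

setup_lifting type_definition_dual

lift_definition dual_apply :: "'a::real_normed_vector dual \<Rightarrow> 'a \<Rightarrow> real" is blinfun_apply .

instantiation dual :: (real_normed_vector) real_normed_vector
begin

lift_definition zero_dual :: "'a dual" is 0 .
lift_definition plus_dual :: "'a dual \<Rightarrow> 'a dual \<Rightarrow> 'a dual" is "(+)" .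
lift_definition minus_dual :: "'a dual \<Rightarrow> 'a dual \<Rightarrow> 'a dual" is "(-)" .
lift_definition uminus_dual :: "'a dual \<Rightarrow> 'a dual" is uminus .
lift_definition scaleR_dual :: "real \<Rightarrow> 'a dual \<Rightarrow> 'a dual" is scaleR .
lift_definition norm_dual :: "'a dual \<Rightarrow> real" is norm .
definition sgn_dual :: "'a dual \<Rightarrow> 'a dual" where "sgn_dual f = inverse (norm f) *\<^sub>R f"
definition dist_dual :: "'a dual \<Rightarrow> 'a dual \<Rightarrow> real" where "dist_dual f g = norm (f - g)"
definition uniformity_dual :: "('a dual \<times> 'a dual) filter"
  where "uniformity_dual = (INF e\<in>{0<..}. principal {(f, g). dist f g < e})"
definition open_dual :: "'a dual set \<Rightarrow> bool"
  where "open_dual S = (\<forall>f\<in>S. \<forall>\<^sub>F (f', g) in uniformity. f' = f \<longrightarrow> g \<in> S)"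

instance
proof
  fix f g h :: "'a dual" and a b :: real and U :: "'a dual set"
  show "f + g + h = f + (g + h)" by transfer simp
  show "f + g = g + f" by transfer simp
  show "0 + f = f" by transfer simp
  show "- f + f = 0" by transfer simp
  show "f - g = f + - g" by transfer simp
  show "a *\<^sub>R (f + g) = a *\<^sub>R f + a *\<^sub>R g" by transfer (simp add: scaleR_add_right)
  show "(a + b) *\<^sub>R f = a *\<^sub>R f + b *\<^sub>R f" by transfer (simp add: scaleR_add_left)
  show "a *\<^sub>R b *\<^sub>R f = (a * b) *\<^sub>R f" by transfer simp
  show "1 *\<^sub>R f = f" by transfer simp
  show "norm f = 0 \<longleftrightarrow> f = 0" by transfer simp
  show "norm (f + g) \<le> norm f + norm g" by transfer (rule norm_triangle_ineq)
  show "norm (a *\<^sub>R f) = \<bar>a\<bar> * norm f" by transfer simp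
  show "sgn f = inverse (norm f) *\<^sub>R f" by (rule sgn_dual_def)
  show "dist f g = norm (f - g)" by (rule dist_dual_def)
  show "uniformity = (INF e\<in>{0<..}. principal {(f, g::'a dual). dist f g < e})"
    by (rule uniformity_dual_def)
  show "open U \<longleftrightarrow> (\<forall>f\<in>U. \<forall>\<^sub>F (f', g) in uniformity. f' = f \<longrightarrow> g \<in> U)"
    by (rule open_dual_def)
qed

end

instance dual :: (real_normed_vector) banach
proof
  fix X :: "nat \<Rightarrow> 'a dual"
  assume "Cauchy X"
  then have "Cauchy (\<lambda>n. blinfun_of_dual (X n))"
    by (simp add: Cauchy_def dist_norm norm_dual.rep_eq minus_dual.rep_eq)
  then obtain L where "(\<lambda>n. blinfun_of_dual (X n)) \<longlonglongrightarrow> L"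
    using Cauchy_convergent convergent_def by blast
  then have "X \<longlonglongrightarrow> dual_of_blinfun L"
    by (simp add: lim_sequentially dist_norm norm_dual.rep_eq minus_dual.rep_eq
        dual_of_blinfun_inverse)
  then show "convergent X" by (auto simp: convergent_def)
qed

lemma dual_eqI: "(\<And>x. dual_apply f x = dual_apply g x) \<Longrightarrow> f = g"
  by transfer (rule blinfun_eqI)

lemma dual_apply_add_left: "dual_apply (f + g) x = dual_apply f x + dual_apply g x"
  by transfer (simp add: blinfun.add_left)

lemma dual_apply_diff_left: "dual_apply (f - g) x = dual_apply f x - dual_apply g x"
  by transfer (simp add: blinfun.diff_left)

lemma dual_apply_minus_left: "dual_apply (- f) x = - dual_apply f x"
  by transfer (simp add: blinfun.minus_left)

lemma dual_apply_scaleR_left: "dual_apply (a *\<^sub>R f) x = a * dual_apply f x"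
  by transfer (simp add: blinfun.scaleR_left)

lemma dual_apply_zero_left: "dual_apply 0 x = 0"
  by transfer simp

lemma dual_apply_add_right: "dual_apply f (x + y) = dual_apply f x + dual_apply f y"
  by transfer (simp add: blinfun.add_right)

lemma dual_apply_diff_right: "dual_apply f (x - y) = dual_apply f x - dual_apply f y"
  by transfer (simp add: blinfun.diff_right)

lemma dual_apply_minus_right: "dual_apply f (- x) = - dual_apply f x"
  by transfer (simp add: blinfun.minus_right)

lemma dual_apply_scaleR_right: "dual_apply f (a *\<^sub>R x) = a * dual_apply f x"
  by transfer (simp add: blinfun.scaleR_right)

lemma dual_apply_zero_right: "dual_apply f 0 = 0"
  by transfer (simp add: blinfun.zero_right)

lemma dual_apply_bound: "\<bar>dual_apply f x\<bar> \<le> norm f * norm x"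
proof transfer
  show "\<bar>blinfun_apply f x\<bar> \<le> norm f * norm x" for f :: "'a \<Rightarrow>\<^sub>L real" and x
    using norm_blinfun[of f x] by simp
qed

lemma dual_norm_le: "0 \<le> b \<Longrightarrow> (\<And>x. \<bar>dual_apply f x\<bar> \<le> b * norm x) \<Longrightarrow> norm f \<le> b"
  by transfer (simp add: norm_blinfun_bound)

instantiation dual :: (banach_lattice) order
begin

definition less_eq_dual :: "'a dual \<Rightarrow> 'a dual \<Rightarrow> bool"
  where "f \<le> g \<longleftrightarrow> (\<forall>x\<ge>0. dual_apply f x \<le> dual_apply g x)"

definition less_dual :: "'a dual \<Rightarrow> 'a dual \<Rightarrow> bool"
  where "less_dual f g \<longleftrightarrow> f \<le> g \<and> \<not> g \<le> f"

instance
proof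
  fix f g h :: "'a dual"
  show "f < g \<longleftrightarrow> f \<le> g \<and> \<not> g \<le> f" by (rule less_dual_def)
  show "f \<le> f" by (simp add: less_eq_dual_def)
  show "f \<le> g \<Longrightarrow> g \<le> h \<Longrightarrow> f \<le> h" by (meson less_eq_dual_def order_trans)
  show "f = g" if "f \<le> g" "g \<le> f"
  proof (rule dual_eqI)
    fix x :: 'a
    have pos: "dual_apply f y = dual_apply g y" if "0 \<le> y" for y
      using \<open>f \<le> g\<close> \<open>g \<le> f\<close> that by (simp add: less_eq_dual_def antisym)
    have "x = pprt x - (- nprt x)" using prts[of x] by simp
    then show "dual_apply f x = dual_apply g x"
      by (metis dual_apply_diff_right pos zero_le_pprt nprt_le_zero neg_0_le_iff_le)
  qed
qed

end

instance dual :: (banach_lattice) ordered_real_vector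
proof
  fix f g h :: "'a dual" and a b :: real
  show "f \<le> g \<Longrightarrow> h + f \<le> h + g" by (simp add: less_eq_dual_def dual_apply_add_left)
  show "f \<le> g \<Longrightarrow> 0 \<le> a \<Longrightarrow> a *\<^sub>R f \<le> a *\<^sub>R g"
    by (simp add: less_eq_dual_def dual_apply_scaleR_left mult_left_mono)
  show "a \<le> b \<Longrightarrow> 0 \<le> f \<Longrightarrow> a *\<^sub>R f \<le> b *\<^sub>R f"
    by (simp add: less_eq_dual_def dual_apply_scaleR_left dual_apply_zero_left mult_right_mono)
qed

text \<open>Existence of the positive part (Riesz--Kantorovich formula).\<close>

lemma dual_positive_part:
  fixes f :: "'a::banach_lattice dual"
  obtains p where "f \<le> p" "0 \<le> p" "\<And>k. f \<le> k \<Longrightarrow> 0 \<le> k \<Longrightarrow> p \<le> k"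
    "\<And>x. 0 \<le> x \<Longrightarrow> dual_apply p x = (SUP y\<in>{0..x}. dual_apply f y)"
proof -
  define q where "q x = (SUP y\<in>{0..x}. dual_apply f y)" for x
  have bound: "dual_apply f y \<le> norm f * norm x" if "y \<in> {0..x}" for x y
  proof -
    have "dual_apply f y \<le> norm f * norm y" using dual_apply_bound[of f y] by simp
    also have "\<dots> \<le> norm f * norm x"
      using that by (intro mult_left_mono norm_mono_pos) auto
    finally show ?thesis .
  qed
  have bdd: "bdd_above (dual_apply f ` {0..x})" for x
    using bound by (intro bdd_aboveI2)
  have upper: "dual_apply f y \<le> q x" if "0 \<le> y" "y \<le> x" for x y
    unfolding q_def using that by (intro cSUP_upper bdd) auto
  have least: "q x \<le> c" if "0 \<le> x" "\<And>y. 0 \<le> y \<Longrightarrow> y \<le> x \<Longrightarrow> dual_apply f y \<le> c" for x c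
    unfolding q_def using that by (intro cSUP_least) auto
  have q_nonneg: "0 \<le> q x" if "0 \<le> x" for x
    using upper[of 0 x] that by (simp add: dual_apply_zero_right)
  have q_bound: "q x \<le> norm f * norm x" if "0 \<le> x" for x
    using that bound by (intro least) auto
  have q_add: "q (x + y) = q x + q y" if xy: "0 \<le> x" "0 \<le> y" for x y
  proof (rule antisym)
    show "q (x + y) \<le> q x + q y"
    proof (rule least)
      show "0 \<le> x + y" using xy by simp
      fix z assume z: "0 \<le> z" "z \<le> x + y"
      have "z - inf z x = sup 0 (z - x)"
        by (simp add: diff_inf_eq_sup add_sup_distrib_left)
      moreover have "sup 0 (z - x) \<le> y"
        using xy z by (simp add: diff_le_eq add.commute)
      ultimately have "dual_apply f (z - inf z x) \<le> q y"
        by (intro upper) auto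
      moreover have "dual_apply f (inf z x) \<le> q x"
        using xy z by (intro upper) auto
      ultimately show "dual_apply f z \<le> q x + q y"
        unfolding dual_apply_diff_right by linarith
    qed
    have "dual_apply f u \<le> q (x + y) - q y" if u: "0 \<le> u" "u \<le> x" for u
    proof -
      have "q y \<le> q (x + y) - dual_apply f u"
      proof (rule least[OF xy(2)])
        fix v assume v: "0 \<le> v" "v \<le> y"
        have "dual_apply f (u + v) \<le> q (x + y)"
          using u v by (intro upper) (auto intro: add_mono)
        then show "dual_apply f v \<le> q (x + y) - dual_apply f u"
          by (simp add: dual_apply_add_right)
      qed
      then show ?thesis by simp
    qed
    then have "q x \<le> q (x + y) - q y" by (rule least[OF xy(1)])
    then show "q x + q y \<le> q (x + y)" by simp
  qed
  have q_scale_le: "q (a *\<^sub>R x) \<le> a * q x" if "0 < a" "0 \<le> x" for a x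
  proof (rule least)
    show "0 \<le> a *\<^sub>R x" using that by (intro scaleR_nonneg_nonneg) auto
    fix y assume y: "0 \<le> y" "y \<le> a *\<^sub>R x"
    have "inverse a *\<^sub>R y \<le> inverse a *\<^sub>R (a *\<^sub>R x)"
      using y that by (intro scaleR_left_mono) auto
    then have "dual_apply f (inverse a *\<^sub>R y) \<le> q x"
      using y that by (intro upper scaleR_nonneg_nonneg) auto
    then show "dual_apply f y \<le> a * q x"
      using that by (simp add: dual_apply_scaleR_right field_simps)
  qed
  have q_0: "q 0 = 0"
    using q_bound[of 0] q_nonneg[of 0] by simp
  have q_scale: "q (a *\<^sub>R x) = a * q x" if "0 \<le> a" "0 \<le> x" for a x
  proof (cases "a = 0")
    case False
    then have a: "0 < a" using that by simp
    have "q (inverse a *\<^sub>R (a *\<^sub>R x)) \<le> inverse a * q (a *\<^sub>R x)"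
      using a that by (intro q_scale_le scaleR_nonneg_nonneg) auto
    then have "a * q x \<le> q (a *\<^sub>R x)" using a by (simp add: field_simps)
    then show ?thesis using q_scale_le[OF a that(2)] by simp
  qed (simp add: q_0)
  define P where "P x = q (pprt x) - q (- nprt x)" for x
  have P_diff: "P (u - v) = q u - q v" if uv: "0 \<le> u" "0 \<le> v" for u v
  proof -
    have "pprt (u - v) + v = - nprt (u - v) + u"
      using prts[of "u - v"] by (simp add: algebra_simps)
    then have "q (pprt (u - v)) + q v = q (- nprt (u - v)) + q u"
      using uv by (simp flip: q_add)
    then show ?thesis by (simp add: P_def)
  qed
  have decomp: "x = pprt x - (- nprt x)" for x :: 'a using prts[of x] by simp
  have P_pos: "P x = q x" if "0 \<le> x" for x
    using P_diff[of x 0] that by (simp add: q_0)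
  have P_add: "P (x + y) = P x + P y" for x y
  proof -
    have "x + y = (pprt x + pprt y) - (- nprt x + - nprt y)"
      using arg_cong2[OF prts[of x] prts[of y], of "(+)"]
      by (simp only: diff_conv_add_uminus minus_add_distrib minus_minus add_ac)
    then have "P (x + y) = q (pprt x + pprt y) - q (- nprt x + - nprt y)"
      by (metis P_diff add_nonneg_nonneg zero_le_pprt nprt_le_zero neg_0_le_iff_le)
    also have "\<dots> = P x + P y"
      using q_add[of "- nprt x" "- nprt y"] q_add[of "pprt x" "pprt y"]
      unfolding P_def by simp
    finally show ?thesis .
  qed
  have P_minus: "P (- x) = - P x" for x
    using P_add[of x "- x"] P_pos[of 0] by (simp add: q_0)
  have P_scale_pos: "P (a *\<^sub>R x) = a * P x" if "0 \<le> a" for a x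
  proof -
    have "a *\<^sub>R x = a *\<^sub>R pprt x - a *\<^sub>R (- nprt x)"
      by (metis decomp scaleR_diff_right)
    then have "P (a *\<^sub>R x) = q (a *\<^sub>R pprt x) - q (a *\<^sub>R (- nprt x))"
      using that by (metis P_diff scaleR_nonneg_nonneg zero_le_pprt nprt_le_zero neg_0_le_iff_le)
    also have "\<dots> = a * P x"
      using that q_scale[of a "pprt x"] q_scale[of a "- nprt x"]
      unfolding P_def by (simp add: right_diff_distrib)
    finally show ?thesis .
  qed
  have P_scale: "P (a *\<^sub>R x) = a *\<^sub>R P x" for a x
  proof (cases "0 \<le> a")
    case False
    then have "P ((- a) *\<^sub>R x) = (- a) * P x" by (intro P_scale_pos) simp
    then show ?thesis by (simp add: P_minus)
  qed (simp add: P_scale_pos)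
  have P_bound: "norm (P x) \<le> norm x * (2 * norm f)" for x
  proof -
    have "norm (pprt x) \<le> norm \<bar>x\<bar>" "norm (- nprt x) \<le> norm \<bar>x\<bar>"
      by (intro norm_mono_pos; simp add: abs_prts)+
    then have "norm f * norm (pprt x) \<le> norm f * norm x" "norm f * norm (- nprt x) \<le> norm f * norm x"
      by (auto intro!: mult_left_mono)
    moreover have "q (pprt x) \<le> norm f * norm (pprt x)" "q (- nprt x) \<le> norm f * norm (- nprt x)"
      by (auto intro!: q_bound simp del: norm_minus_cancel)
    moreover have "0 \<le> q (pprt x)" "0 \<le> q (- nprt x)" by (auto intro!: q_nonneg)
    ultimately have "\<bar>P x\<bar> \<le> 2 * (norm f * norm x)"
      unfolding P_def norm_minus_cancel abs_le_iff by linarith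
    then show ?thesis by (simp add: mult_ac)
  qed
  have "bounded_linear P"
    by (rule bounded_linear_intro[OF P_add P_scale P_bound])
  define p where "p = dual_of_blinfun (Blinfun P)"
  have p: "dual_apply p x = P x" for x
    using \<open>bounded_linear P\<close>
    by (simp add: p_def dual_apply.rep_eq dual_of_blinfun_inverse bounded_linear_Blinfun_apply)
  show thesis
  proof (rule that[of p])
    show "f \<le> p" by (simp add: less_eq_dual_def p P_pos upper)
    show "0 \<le> p" by (simp add: less_eq_dual_def p P_pos q_nonneg dual_apply_zero_left)
    show "dual_apply p x = (SUP y\<in>{0..x}. dual_apply f y)" if "0 \<le> x" for x
      using that by (simp add: p P_pos q_def)
    fix k assume k: "f \<le> k" "0 \<le> k"
    show "p \<le> k"
      unfolding less_eq_dual_def p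
    proof (intro allI impI)
      fix x :: 'a assume x: "0 \<le> x"
      have "q x \<le> dual_apply k x"
      proof (rule least[OF x])
        fix y assume y: "0 \<le> y" "y \<le> x"
        have "dual_apply f y \<le> dual_apply k y" using k y by (simp add: less_eq_dual_def)
        moreover have "0 \<le> dual_apply k (x - y)"
          using k(2) y by (simp add: less_eq_dual_def dual_apply_zero_left)
        ultimately show "dual_apply f y \<le> dual_apply k x"
          by (simp add: dual_apply_diff_right)
      qed
      then show "P x \<le> dual_apply k x" by (simp add: P_pos x)
    qed
  qed
qed

lemma dual_sup_exists:
  fixes f g :: "'a::banach_lattice dual"
  shows "\<exists>!s. f \<le> s \<and> g \<le> s \<and> (\<forall>k. f \<le> k \<and> g \<le> k \<longrightarrow> s \<le> k)"
proof -
  obtain p where p: "f - g \<le> p" "0 \<le> p" "\<And>k. f - g \<le> k \<Longrightarrow> 0 \<le> k \<Longrightarrow> p \<le> k"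
    by (rule dual_positive_part[of "f - g"]) blast
  have "f \<le> p + g" using p(1) by (simp add: diff_le_eq)
  moreover have "g \<le> p + g" using p(2) by simp
  moreover have "p + g \<le> k" if "f \<le> k" "g \<le> k" for k
    using p(3)[of "k - g"] that by (simp add: le_diff_eq)
  ultimately show ?thesis by (intro ex1I[of _ "p + g"]) (auto intro: antisym)
qed

instantiation dual :: (banach_lattice) lattice_ab_group_add_abs
begin

definition sup_dual :: "'a dual \<Rightarrow> 'a dual \<Rightarrow> 'a dual"
  where "sup_dual f g = (THE s. f \<le> s \<and> g \<le> s \<and> (\<forall>k. f \<le> k \<and> g \<le> k \<longrightarrow> s \<le> k))"

definition inf_dual :: "'a dual \<Rightarrow> 'a dual \<Rightarrow> 'a dual"
  where "inf_dual f g = - sup (- f) (- g)"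

definition abs_dual :: "'a dual \<Rightarrow> 'a dual"
  where "abs_dual f = sup f (- f)"

instance
proof
  fix f g h :: "'a dual"
  have sup: "f \<le> sup f g \<and> g \<le> sup f g \<and> (\<forall>k. f \<le> k \<and> g \<le> k \<longrightarrow> sup f g \<le> k)"
    for f g :: "'a dual"
    unfolding sup_dual_def by (rule theI'[OF dual_sup_exists])
  show "f \<le> sup f g" "g \<le> sup f g" using sup by blast+
  show "g \<le> f \<Longrightarrow> h \<le> f \<Longrightarrow> sup g h \<le> f" using sup by blast
  show "inf f g \<le> f" "inf f g \<le> g"
    unfolding inf_dual_def using sup[of "- f" "- g"] by (simp_all add: minus_le_iff)
  show "f \<le> g \<Longrightarrow> f \<le> h \<Longrightarrow> f \<le> inf g h"
    unfolding inf_dual_def using sup[of "- g" "- h"] by (metis le_minus_iff neg_le_iff_le)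
  show "\<bar>f\<bar> = sup f (- f)" by (rule abs_dual_def)
qed

end

lemma dual_apply_le_abs: "\<bar>dual_apply f x\<bar> \<le> dual_apply \<bar>f\<bar> \<bar>x\<bar>"
  for f :: "'a::banach_lattice dual"
proof -
  have pos: "\<bar>dual_apply f y\<bar> \<le> dual_apply \<bar>f\<bar> y" if "0 \<le> y" for y
    using abs_ge_self[of f] abs_ge_minus_self[of f] that
    by (simp add: less_eq_dual_def dual_apply_minus_left abs_le_iff)
  have "dual_apply f x = dual_apply f (pprt x) - dual_apply f (- nprt x)"
    using prts[of x] by (metis dual_apply_diff_right diff_minus_eq_add)
  moreover have "dual_apply (\<bar>f\<bar>) (\<bar>x\<bar>) = dual_apply (\<bar>f\<bar>) (pprt x) + dual_apply (\<bar>f\<bar>) (- nprt x)"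
    by (simp add: abs_prts flip: dual_apply_add_right)
  ultimately show ?thesis
    using pos[of "pprt x"] pos[of "- nprt x"] by simp
qed

lemma dual_apply_abs_le_norm:
  fixes g :: "'a::banach_lattice dual"
  assumes x: "0 \<le> x"
  shows "dual_apply \<bar>g\<bar> x \<le> norm g * norm x"
proof -
  obtain p where p: "g \<le> p" "0 \<le> p"
    "\<And>x. 0 \<le> x \<Longrightarrow> dual_apply p x = (SUP y\<in>{0..x}. dual_apply g y)"
    by (rule dual_positive_part[of g]) blast
  have "- g \<le> 2 *\<^sub>R p - g" using p(2) by (simp add: scaleR_2)
  moreover have "g \<le> 2 *\<^sub>R p - g"
    using add_mono[OF p(1) p(1)] by (simp add: scaleR_2 le_diff_eq)
  ultimately have "\<bar>g\<bar> \<le> 2 *\<^sub>R p - g" by (simp add: abs_lattice)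
  then have "dual_apply \<bar>g\<bar> x \<le> 2 * dual_apply p x - dual_apply g x"
    using x by (simp add: less_eq_dual_def dual_apply_diff_left dual_apply_scaleR_left)
  moreover have "dual_apply p x \<le> (norm g * norm x + dual_apply g x) / 2"
    unfolding p(3)[OF x]
  proof (rule cSUP_least)
    show "{0..x} \<noteq> {}" using x by auto
    fix y assume y: "y \<in> {0..x}"
    have "\<bar>y + y - x\<bar> \<le> \<bar>x\<bar>"
      using y x by (simp add: abs_lattice[of "y + y - x"] diff_le_eq add_mono)
    then have "norm g * norm (y + y - x) \<le> norm g * norm x"
      by (intro mult_left_mono norm_mono) auto
    then have "dual_apply g (y + y - x) \<le> norm g * norm x"
      using dual_apply_bound[of g "y + y - x"] by simp
    then show "dual_apply g y \<le> (norm g * norm x + dual_apply g x) / 2"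
      by (simp add: dual_apply_diff_right dual_apply_add_right)
  qed
  ultimately show ?thesis by simp
qed

instance dual :: (banach_lattice) banach_lattice
proof
  fix f g :: "'a dual"
  assume fg: "\<bar>f\<bar> \<le> \<bar>g\<bar>"
  show "norm f \<le> norm g"
  proof (rule dual_norm_le)
    fix x :: 'a
    have "\<bar>dual_apply f x\<bar> \<le> dual_apply \<bar>f\<bar> \<bar>x\<bar>" by (rule dual_apply_le_abs)
    also have "\<dots> \<le> dual_apply \<bar>g\<bar> \<bar>x\<bar>" using fg by (simp add: less_eq_dual_def)
    also have "\<dots> \<le> norm g * norm x" using dual_apply_abs_le_norm[of "\<bar>x\<bar>" g] by simp
    finally show "\<bar>dual_apply f x\<bar> \<le> norm g * norm x" .
  qed simp
qed


section \<open>Order continuous norms, L-weak and M-weak compactness\<close>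

definition disjoint_seq :: "(nat \<Rightarrow> 'a::banach_lattice) \<Rightarrow> bool"
  where "disjoint_seq x \<longleftrightarrow> (\<forall>m n. m \<noteq> n \<longrightarrow> inf \<bar>x m\<bar> \<bar>x n\<bar> = 0)"

definition order_bounded :: "'a::banach_lattice set \<Rightarrow> bool"
  where "order_bounded A \<longleftrightarrow> (\<exists>a b. A \<subseteq> {a..b})"

definition solid :: "'a::banach_lattice set \<Rightarrow> bool"
  where "solid S \<longleftrightarrow> (\<forall>x y. y \<in> S \<and> \<bar>x\<bar> \<le> \<bar>y\<bar> \<longrightarrow> x \<in> S)"

lemma solid_hull: "solid hull A = {x. \<exists>a\<in>A. \<bar>x\<bar> \<le> \<bar>a\<bar>}"
  by (rule hull_unique) (auto simp: solid_def intro: order_trans)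

text \<open>Order continuity of the norm: \<open>norm (x\<^sub>i) \<longlongrightarrow> 0\<close> for every net \<open>x\<^sub>i \<down> 0\<close>.  Since HOL does
  not quantify over index types, a decreasing net is represented by its range, a downward
  directed set indexed by itself; nets over arbitrary index types are covered by
  \<open>order_continuous_norm_net\<close> below.\<close>

definition order_continuous_norm :: "'a::banach_lattice itself \<Rightarrow> bool"
  where "order_continuous_norm _ \<longleftrightarrow>
    (\<forall>D::'a set. D \<noteq> {} \<and> (\<forall>x\<in>D. \<forall>y\<in>D. \<exists>z\<in>D. z \<le> x \<and> z \<le> y) \<and>
        (\<forall>x\<in>D. 0 \<le> x) \<and> (\<forall>l. (\<forall>x\<in>D. l \<le> x) \<longrightarrow> l \<le> 0) \<longrightarrow>
      (norm \<longlongrightarrow> 0) (INF x\<in>D. principal {y\<in>D. y \<le> x}))"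

lemma order_continuous_norm_net:
  fixes x :: "'i \<Rightarrow> 'a::banach_lattice" and I :: "'i set" and r :: "'i \<Rightarrow> 'i \<Rightarrow> bool"
  assumes "order_continuous_norm TYPE('a)"
    and I: "I \<noteq> {}" "\<And>i. i \<in> I \<Longrightarrow> r i i"
      "\<And>i j k. i \<in> I \<Longrightarrow> j \<in> I \<Longrightarrow> k \<in> I \<Longrightarrow> r i j \<Longrightarrow> r j k \<Longrightarrow> r i k"
      "\<And>i j. i \<in> I \<Longrightarrow> j \<in> I \<Longrightarrow> \<exists>k\<in>I. r i k \<and> r j k"
    and x: "\<And>i j. i \<in> I \<Longrightarrow> j \<in> I \<Longrightarrow> r i j \<Longrightarrow> x j \<le> x i"
      "\<And>i. i \<in> I \<Longrightarrow> 0 \<le> x i" "\<And>l. (\<And>i. i \<in> I \<Longrightarrow> l \<le> x i) \<Longrightarrow> l \<le> 0"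
  shows "((\<lambda>i. norm (x i)) \<longlongrightarrow> 0) (INF i\<in>I. principal {j\<in>I. r i j})"
proof -
  have dir: "\<exists>k\<in>I. x k \<le> x i \<and> x k \<le> x j" if "i \<in> I" "j \<in> I" for i j
    using I(4)[OF that] x(1) that by meson
  have "(norm \<longlongrightarrow> 0) (INF y\<in>x ` I. principal {z\<in>x ` I. z \<le> y})"
  proof (rule assms(1)[unfolded order_continuous_norm_def, rule_format], intro conjI ballI allI impI)
    show "l \<le> 0" if "\<forall>y\<in>x ` I. l \<le> y" for l using that by (intro x(3)) auto
  qed (use I(1) x(2) dir in auto)
  moreover have "filterlim x (INF y\<in>x ` I. principal {z\<in>x ` I. z \<le> y}) (INF i\<in>I. principal {j\<in>I. r i j})"
    unfolding filterlim_INF filterlim_principal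
  proof (intro ballI)
    fix y assume "y \<in> x ` I"
    then obtain i where i: "i \<in> I" "y = x i" by auto
    have "\<forall>\<^sub>F j in principal {j\<in>I. r i j}. x j \<in> {z\<in>x ` I. z \<le> y}"
      using i x(1) by (auto simp: eventually_principal)
    then show "\<forall>\<^sub>F j in (INF i\<in>I. principal {j\<in>I. r i j}). x j \<in> {z\<in>x ` I. z \<le> y}"
      using i(1) by (intro eventually_INF1)
  qed
  ultimately show ?thesis by (rule filterlim_compose)
qed

definition L_weakly_compact :: "'a::banach_lattice set \<Rightarrow> bool"
  where "L_weakly_compact A \<longleftrightarrow> A \<noteq> {} \<and> bounded A \<and>
    (\<forall>x. disjoint_seq x \<and> range x \<subseteq> solid hull A \<longrightarrow> (\<lambda>n. norm (x n)) \<longlonglongrightarrow> 0)"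

definition order_L_weakly_compact :: "('a::banach_lattice \<Rightarrow>\<^sub>L 'b::banach_lattice) \<Rightarrow> bool"
  where "order_L_weakly_compact T \<longleftrightarrow> (\<forall>x\<ge>0. L_weakly_compact (blinfun_apply T ` {0..x}))"

definition order_M_weakly_compact :: "('a::banach_lattice \<Rightarrow>\<^sub>L 'b::banach_lattice) \<Rightarrow> bool"
  where "order_M_weakly_compact T \<longleftrightarrow>
    (\<forall>(x :: nat \<Rightarrow> 'a) (f :: nat \<Rightarrow> 'b dual).
      disjoint_seq x \<and> range x \<subseteq> cball 0 1 \<and> order_bounded (range f) \<longrightarrow>
      (\<lambda>n. dual_apply (f n) (blinfun_apply T (x n))) \<longlonglongrightarrow> 0)"

end

theory Submission
  imports Defs
begin

text \<open>The cycle is (2) to (1) to (3) to (2); (4) unfolds to (3).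
  Under (2), a disjoint sequence below \<open>f\<close> has partial sums bounded by \<open>f\<close>, so its terms tend to
  \<open>0\<close> in norm.  For (1) to (3), restrict a positive functional \<open>f\<close> to the bands generated by
  disjoint vectors \<open>x\<^sub>n\<close>: this gives disjoint \<open>g\<^sub>n \<le> f\<close> with \<open>g\<^sub>n \<bar>x\<^sub>n\<bar> = f \<bar>x\<^sub>n\<bar>\<close>, so
  \<open>f \<bar>x\<^sub>n\<bar> \<le> norm g\<^sub>n\<close>.  For (3) to (2), a family of functionals decreasing to \<open>0\<close> does so
  pointwise; if the norms stayed above \<open>e\<close>, one could choose inductively a decreasing sequence
  \<open>f\<^sub>n\<close> and positive unit vectors \<open>x\<^sub>n\<close> with \<open>f\<^sub>n x\<^sub>n > e/2\<close>, but \<open>f\<^sub>n\<close> tiny on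
  the earlier \<open>x\<^sub>i\<close>; making the \<open>x\<^sub>n\<close> disjoint at small cost then contradicts (3).\<close>

section \<open>Banach lattices\<close>

text \<open>Directedness makes the sections a filter base, and the norm is monotone on the positive
  cone, so one element of norm below \<open>e\<close> controls the whole section beneath it.\<close>

lemma order_continuous_norm_iff:
  "order_continuous_norm TYPE('a::banach_lattice) \<longleftrightarrow>
    (\<forall>D::'a set. D \<noteq> {} \<and> (\<forall>x\<in>D. \<forall>y\<in>D. \<exists>z\<in>D. z \<le> x \<and> z \<le> y) \<and>
        (\<forall>x\<in>D. 0 \<le> x) \<and> (\<forall>l. (\<forall>x\<in>D. l \<le> x) \<longrightarrow> l \<le> 0) \<longrightarrow>
      (\<forall>e>0. \<exists>x\<in>D. norm x < e))"
proof -
  have "(norm \<longlongrightarrow> 0) (INF x\<in>D. principal {y\<in>D. y \<le> x}) \<longleftrightarrow> (\<forall>e>0. \<exists>x\<in>D. norm x < e)"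
    if D: "D \<noteq> {}" "\<forall>x\<in>D. \<forall>y\<in>D. \<exists>z\<in>D. z \<le> x \<and> z \<le> y" "\<forall>x\<in>D. 0 \<le> x" for D :: "'a set"
  proof -
    have ev: "eventually P (INF x\<in>D. principal {y\<in>D. y \<le> x}) \<longleftrightarrow> (\<exists>x\<in>D. \<forall>y\<in>D. y \<le> x \<longrightarrow> P y)"
      for P
    proof (subst eventually_INF_base)
      fix a b assume "a \<in> D" "b \<in> D"
      then obtain c where "c \<in> D" "c \<le> a" "c \<le> b" using D(2) by blast
      then show "\<exists>x\<in>D. principal {y \<in> D. y \<le> x}
          \<le> inf (principal {y \<in> D. y \<le> a}) (principal {y \<in> D. y \<le> b})"
        by (intro bexI[of _ c]) auto
    qed (use D(1) in \<open>auto simp: eventually_principal\<close>)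
    show ?thesis
      unfolding tendsto_iff ev dist_norm
    proof (intro iff_allI imp_cong refl bex_cong)
      fix e :: real and x assume x: "x \<in> D"
      have "norm y \<le> norm x" if "y \<in> D" "y \<le> x" for y
        using that D(3) by (intro norm_mono_pos) auto
      then show "(\<forall>y\<in>D. y \<le> x \<longrightarrow> norm (norm y - 0) < e) \<longleftrightarrow> norm x < e"
        using x by fastforce
    qed
  qed
  then show ?thesis
    unfolding order_continuous_norm_def by (intro iff_allI imp_cong) auto
qed

section \<open>Order inequalities and closedness of the positive cone\<close>

lemma inf_add_le:
  fixes a b c :: "'a::banach_lattice"
  assumes "0 \<le> a" "0 \<le> b" "0 \<le> c"
  shows "inf (a + b) c \<le> inf a c + inf b c"
proof -
  let ?z = "inf (a + b) c"
  \<comment> \<open>\<open>?z - b\<close> lies below \<open>a\<close> and \<open>c\<close>, hence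
    below \<open>inf a c\<close>; rearranged, \<open>?z - inf a c\<close> lies below
    \<open>b\<close>, and also below \<open>c\<close> because \<open>inf a c\<close> is
    positive.\<close>
  have "?z - b \<le> ?z" using assms(2) by (simp only: diff_le_eq le_add_same_cancel1)
  then have "?z - b \<le> c" by (rule order_trans) simp
  then have "?z - b \<le> inf a c" by (simp add: diff_le_eq)
  then have "?z - inf a c \<le> b" by (simp only: diff_le_eq add.commute)
  moreover have "?z - inf a c \<le> c - 0" using assms by (intro diff_mono) auto
  ultimately have "?z - inf a c \<le> inf b c" by simp
  then show ?thesis by (simp only: diff_le_eq add.commute)
qed

text \<open>For \<open>k > 0\<close>, dividing by \<open>k\<close>, passing to the positive part and
  multiplying back gives \<open>real k *\<^sub>R pprt l \<le> \<bar>v\<bar>\<close>. By monotonicity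
  of the norm all multiples of \<open>norm (pprt l)\<close> are bounded by \<open>norm v\<close>, so
  \<open>pprt l\<close> vanishes.\<close>

lemma archimedean_nonpos:
  fixes l v :: "'a::banach_lattice"
  assumes "\<And>k::nat. real k *\<^sub>R l \<le> v"
  shows "l \<le> 0"
proof -
  have "norm (pprt l) * real k \<le> norm v" for k
  proof -
    have "real k *\<^sub>R pprt l \<le> \<bar>v\<bar>"
    proof (cases "k = 0")
      case False
      have "real k *\<^sub>R l \<le> \<bar>v\<bar>" using assms[of k] abs_ge_self order_trans by blast
      then have "inverse (real k) *\<^sub>R (real k *\<^sub>R l) \<le> inverse (real k) *\<^sub>R \<bar>v\<bar>"
        by (intro scaleR_left_mono) auto
      then have "l \<le> inverse (real k) *\<^sub>R \<bar>v\<bar>" using False by simp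
      moreover have "0 \<le> inverse (real k) *\<^sub>R \<bar>v\<bar>" by (intro scaleR_nonneg_nonneg) auto
      ultimately have "pprt l \<le> inverse (real k) *\<^sub>R \<bar>v\<bar>" by (simp add: pprt_def)
      then have "real k *\<^sub>R pprt l \<le> real k *\<^sub>R (inverse (real k) *\<^sub>R \<bar>v\<bar>)"
        by (intro scaleR_left_mono) auto
      then show ?thesis using False by simp
    qed simp
    then have "norm (real k *\<^sub>R pprt l) \<le> norm \<bar>v\<bar>"
      by (intro norm_mono_pos scaleR_nonneg_nonneg) auto
    then show ?thesis by (simp add: mult.commute)
  qed
  moreover have "\<exists>k. norm v < real k * norm (pprt l)" if "pprt l \<noteq> 0"
    using that reals_Archimedean3[of "norm (pprt l)"] by simp
  ultimately have "pprt l = 0" by (metis mult.commute linorder_not_le)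
  then show ?thesis by (simp add: le_zero_iff_zero_pprt)
qed

text \<open>For \<open>n \<ge> N\<close> the vector \<open>pprt (a - x)\<close> lies below
  \<open>\<bar>s n - x\<bar>\<close>, whose norm tends to \<open>0\<close>.\<close>

lemma lim_ge:
  fixes a :: "'a::banach_lattice"
  assumes "s \<longlonglongrightarrow> x" "\<And>n. n \<ge> N \<Longrightarrow> a \<le> s n"
  shows "a \<le> x"
proof -
  have "norm (pprt (a - x)) \<le> norm (s n - x)" if "n \<ge> N" for n
  proof -
    have "a - x \<le> s n - x" using assms(2)[OF that] by simp
    also have "\<dots> \<le> \<bar>s n - x\<bar>" by (rule abs_ge_self)
    finally have "pprt (a - x) \<le> \<bar>s n - x\<bar>" by (simp add: pprt_def)
    then have "norm (pprt (a - x)) \<le> norm \<bar>s n - x\<bar>" by (intro norm_mono_pos) auto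
    then show ?thesis by simp
  qed
  moreover have "(\<lambda>n. norm (s n - x)) \<longlonglongrightarrow> 0"
    using assms(1) by (simp add: LIM_zero tendsto_norm_zero)
  ultimately have "norm (pprt (a - x)) \<le> 0"
    by (intro Lim_bounded2) auto
  then have "a - x \<le> 0" by (simp only: le_zero_iff_zero_pprt[of "a - x"] norm_le_zero_iff)
  then show ?thesis by simp
qed

section \<open>Disjoint sequences\<close>

text \<open>By \<open>inf_add_le\<close> a partial sum stays disjoint from every later term, so
  adding the next term amounts to taking a supremum, and \<open>f\<close> bounds both
  members.\<close>

lemma disjoint_sum_le:
  fixes g :: "nat \<Rightarrow> 'a::banach_lattice"
  assumes "disjoint_seq g" "\<And>n. \<bar>g n\<bar> \<le> f"
  shows "(\<Sum>i<n. \<bar>g i\<bar>) \<le> f"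
proof -
  have disj: "inf (\<Sum>i<n. \<bar>g i\<bar>) \<bar>g k\<bar> = 0" if "n \<le> k" for n k
    using that
  proof (induction n)
    case (Suc n)
    have "inf (\<Sum>i<Suc n. \<bar>g i\<bar>) \<bar>g k\<bar> \<le> inf (\<Sum>i<n. \<bar>g i\<bar>) \<bar>g k\<bar> + inf \<bar>g n\<bar> \<bar>g k\<bar>"
      by (simp add: inf_add_le sum_nonneg)
    also have "\<dots> = 0" using Suc assms(1) by (simp add: disjoint_seq_def)
    finally show ?case by (intro antisym) (auto intro: sum_nonneg)
  qed (simp add: inf_absorb1)
  show ?thesis
  proof (induction n)
    case 0
    then show ?case using order_trans[OF abs_ge_zero assms(2)[of 0]] by simp
  next
    case (Suc n)
    have "(\<Sum>i<Suc n. \<bar>g i\<bar>) = sup (\<Sum>i<n. \<bar>g i\<bar>) \<bar>g n\<bar>"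
      using add_eq_inf_sup[of "\<Sum>i<n. \<bar>g i\<bar>" "\<bar>g n\<bar>"] disj[of n n] by simp
    then show ?case using Suc assms(2) by simp
  qed
qed

text \<open>Without Dedekind completeness the gaps \<open>u - s\<close> between upper bounds \<open>u\<close> of the partial
  sums and the partial sums \<open>s\<close> themselves still decrease to \<open>0\<close>, by the Archimedean property.\<close>

lemma order_continuous_norm_disjoint_null:
  fixes g :: "nat \<Rightarrow> 'a::banach_lattice"
  assumes ocn: "order_continuous_norm TYPE('a)"
    and g: "disjoint_seq g" "\<And>n. \<bar>g n\<bar> \<le> f"
  shows "(\<lambda>n. norm (g n)) \<longlonglongrightarrow> 0"
proof -
  define s where "s n = (\<Sum>i<n. \<bar>g i\<bar>)" for n
  have s_mono: "s m \<le> s n" if "m \<le> n" for m n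
    unfolding s_def using that by (intro sum_mono2) auto
  define U where "U = {u. \<forall>n. s n \<le> u}"
  have "f \<in> U" using disjoint_sum_le[OF g] by (simp add: U_def s_def)
  define D where "D = {u - s n |u n. u \<in> U}"
  have "\<forall>e>0. \<exists>x\<in>D. norm x < e"
  proof (rule ocn[unfolded order_continuous_norm_iff, THEN spec, THEN mp], intro conjI ballI allI impI)
    show "D \<noteq> {}" using \<open>f \<in> U\<close> by (auto simp: D_def)
    show "\<exists>z\<in>D. z \<le> x \<and> z \<le> y" if xy: "x \<in> D" "y \<in> D" for x y
    proof -
      obtain u m v n where x: "x = u - s m" "u \<in> U" and y: "y = v - s n" "v \<in> U"
        using xy by (auto simp: D_def)
      have "inf u v - s (max m n) \<in> D" using x y by (auto simp: D_def U_def)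
      moreover have "inf u v - s (max m n) \<le> x" "inf u v - s (max m n) \<le> y"
        unfolding x y by (intro diff_mono s_mono; simp)+
      ultimately show ?thesis by blast
    qed
    show "0 \<le> x" if "x \<in> D" for x using that by (auto simp: D_def U_def)
    show "l \<le> 0" if l: "\<forall>x\<in>D. l \<le> x" for l
    proof -
      \<comment> \<open>A lower bound \<open>l\<close> of \<open>D\<close> satisfies
        \<open>l \<le> u - s n\<close> for all \<open>n\<close> and all \<open>u\<close> in
        \<open>U\<close>, so \<open>u - l\<close> is in \<open>U\<close> again; this repeats
        indefinitely.\<close>
      have "f - real k *\<^sub>R l \<in> U" for k
      proof (induction k)
        case 0
        then show ?case using \<open>f \<in> U\<close> by simp
      next
        case (Suc k)
        have "l \<le> (f - real k *\<^sub>R l) - s n" for n using Suc l by (auto simp: D_def)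
        then show ?case by (auto simp: U_def algebra_simps)
      qed
      then have "s 0 \<le> f - real k *\<^sub>R l" for k by (simp add: U_def)
      then have "real k *\<^sub>R l \<le> f" for k by (simp add: s_def)
      then show ?thesis by (rule archimedean_nonpos)
    qed
  qed
  show ?thesis
  proof (rule LIMSEQ_I)
    fix e :: real assume "e > 0"
    then obtain u n where un: "u \<in> U" "norm (u - s n) < e"
      using \<open>\<forall>e>0. \<exists>x\<in>D. norm x < e\<close> by (auto simp: D_def)
    have "norm (norm (g m) - 0) < e" if "m \<ge> n" for m
    proof -
      \<comment> \<open>A single term is the increment between two partial sums, both of which lie
        between \<open>s n\<close> and \<open>u\<close> once \<open>m \<ge> n\<close>.\<close>
      have "\<bar>g m\<bar> = s (Suc m) - s m" by (simp add: s_def)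
      also have "\<dots> \<le> u - s n" using un that by (intro diff_mono s_mono) (auto simp: U_def)
      finally have "norm \<bar>g m\<bar> \<le> norm (u - s n)" by (intro norm_mono_pos) auto
      then show ?thesis using un by simp
    qed
    then show "\<exists>no. \<forall>m\<ge>no. norm (norm (g m) - 0) < e" by blast
  qed
qed

text \<open>The two arguments are the translates of \<open>0\<close> and \<open>x\<close> by
  \<open>- nprt x\<close>, so their infimum is the same translate of \<open>inf x 0\<close>, which
  is \<open>nprt x\<close>.\<close>

lemma inf_nprt_pprt: "inf (- nprt x) (pprt x) = 0" for x :: "'a::banach_lattice"
proof -
  have "- nprt x + x = pprt x"
    using prts[of x] by (metis add.commute add_diff_cancel_right' diff_conv_add_uminus)
  then have "inf (- nprt x) (pprt x) = inf (- nprt x + 0) (- nprt x + x)" by simp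
  also have "\<dots> = - nprt x + inf x 0" by (simp only: add_inf_distrib_left inf.commute)
  finally show ?thesis by (simp only: nprt_def left_minus)
qed

text \<open>For \<open>m < n\<close> the subtracted terms give \<open>y\<^sub>n \<le> pprt v\<close> and \<open>4\<^sup>n y\<^sub>m \<le> pprt (- v)\<close> with
  \<open>v = x\<^sub>n - 4\<^sup>n x\<^sub>m\<close>.\<close>

lemma disjoint_pprt:
  fixes x :: "nat \<Rightarrow> 'a::banach_lattice"
  assumes x: "\<And>n. 0 \<le> x n" and z: "\<And>n. (1/2)^n *\<^sub>R x n \<le> z"
  shows "disjoint_seq (\<lambda>n. pprt (x n - 4^n *\<^sub>R (\<Sum>i<n. x i) - (1/2)^n *\<^sub>R z))"
proof -
  define y where "y n = pprt (x n - 4^n *\<^sub>R (\<Sum>i<n. x i) - (1/2)^n *\<^sub>R z)" for n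
  have z0: "0 \<le> z" using x[of 0] z[of 0] by simp
  have less: "inf (y m) (y n) = 0" if mn: "m < n" for m n
  proof -
    let ?v = "x n - 4^n *\<^sub>R x m"
    have "x m \<le> (\<Sum>i<n. x i)" using mn x sum_mono2[of "{..<n}" "{m}" x] by auto
    then have "4^n *\<^sub>R x m \<le> 4^n *\<^sub>R (\<Sum>i<n. x i)" by (intro scaleR_left_mono) auto
    moreover have "0 \<le> (1/2)^n *\<^sub>R z" using z0 by (intro scaleR_nonneg_nonneg) auto
    ultimately have "x n - 4^n *\<^sub>R (\<Sum>i<n. x i) - (1/2)^n *\<^sub>R z \<le> ?v - 0"
      by (intro diff_mono) auto
    then have yn: "y n \<le> pprt ?v" unfolding y_def pprt_def by (intro sup_mono) auto
    have "0 \<le> 4^m *\<^sub>R (\<Sum>i<m. x i)" using x by (intro scaleR_nonneg_nonneg sum_nonneg) auto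
    then have "y m \<le> pprt (x m - (1/2)^m *\<^sub>R z)"
      unfolding y_def pprt_def by (intro sup_mono) (auto simp: algebra_simps)
    also have "\<dots> \<le> (1/4)^n *\<^sub>R pprt (- ?v)"
    proof -
      \<comment> \<open>This is the purpose of \<open>z\<close>: since
        \<open>(1/2)^n *\<^sub>R x n \<le> z\<close> and \<open>m < n\<close>, the term subtracted
        in \<open>y m\<close> dominates \<open>(1/4)^n *\<^sub>R x n\<close>.\<close>
      have "(1/4)^n *\<^sub>R x n \<le> ((1/2)^m * (1/2)^n) *\<^sub>R x n"
      proof (intro scaleR_right_mono x)
        have "(1/4::real)^n = (1/2)^n * (1/2)^n" by (simp flip: power_mult_distrib)
        also have "\<dots> \<le> (1/2)^m * (1/2)^n"
          using mn by (intro mult_right_mono power_decreasing) auto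
        finally show "(1/4::real)^n \<le> (1/2)^m * (1/2)^n" .
      qed
      also have "\<dots> \<le> (1/2)^m *\<^sub>R z"
        using scaleR_left_mono[OF z[of n], of "(1/2)^m"] by simp
      finally have "x m - (1/2)^m *\<^sub>R z \<le> x m - (1/4)^n *\<^sub>R x n" by simp
      also have "\<dots> = (1/4)^n *\<^sub>R (- ?v)"
        by (simp add: algebra_simps flip: power_mult_distrib)
      also have "\<dots> \<le> (1/4)^n *\<^sub>R pprt (- ?v)"
        by (intro scaleR_left_mono) (auto simp: pprt_def)
      finally show ?thesis
        unfolding pprt_def[of "x m - _"] by (simp add: scaleR_nonneg_nonneg)
    qed
    also have "\<dots> \<le> 1 *\<^sub>R pprt (- ?v)"
      by (intro scaleR_right_mono) (auto simp: power_le_one)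
    finally have ym: "y m \<le> - nprt ?v" by (simp only: pprt_neg scaleR_one)
    have "inf (y m) (y n) \<le> inf (- nprt ?v) (pprt ?v)" using ym yn by (intro inf_mono)
    also have "\<dots> = 0" by (rule inf_nprt_pprt)
    finally show ?thesis by (intro antisym) (auto simp: y_def)
  qed
  have "\<bar>y n\<bar> = y n" for n by (simp add: y_def)
  moreover have "inf (y m) (y n) = 0" if "m \<noteq> n" for m n
    using less[of m n] less[of n m] that by (auto simp: inf.commute neq_iff)
  ultimately show ?thesis unfolding disjoint_seq_def y_def by simp
qed

section \<open>Positive functionals\<close>

lemma dual_nonneg: "0 \<le> (f::'a::banach_lattice dual) \<Longrightarrow> 0 \<le> x \<Longrightarrow> 0 \<le> dual_apply f x"
  by (simp add: less_eq_dual_def dual_apply_zero_left)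

lemma dual_mono:
  "0 \<le> (f::'a::banach_lattice dual) \<Longrightarrow> x \<le> y \<Longrightarrow> dual_apply f x \<le> dual_apply f y"
  using dual_nonneg[of f "y - x"] by (simp add: dual_apply_diff_right)

lemma dual_le: "(f::'a::banach_lattice dual) \<le> g \<Longrightarrow> 0 \<le> x \<Longrightarrow> dual_apply f x \<le> dual_apply g x"
  by (simp add: less_eq_dual_def)

section \<open>Functionals constructed from their values on the cone\<close>

text \<open>Extension by \<open>q (pprt x) - q (pprt (- x))\<close>. It serves to turn both a
  supremum over truncations and an infimum over a directed set of functionals into elements of the
  dual.\<close>

lemma cone_functional_extension:
  fixes q :: "'a::banach_lattice \<Rightarrow> real"
  assumes q_add: "\<And>x y. 0 \<le> x \<Longrightarrow> 0 \<le> y \<Longrightarrow> q (x + y) = q x + q y"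
    and q_scale_le: "\<And>a x. 0 < a \<Longrightarrow> 0 \<le> x \<Longrightarrow> q (a *\<^sub>R x) \<le> a * q x"
    and q_nonneg: "\<And>x. 0 \<le> x \<Longrightarrow> 0 \<le> q x"
    and q_bound: "\<And>x. 0 \<le> x \<Longrightarrow> q x \<le> C * norm x" and C: "0 \<le> C"
  obtains g :: "'a dual" where "\<And>x. 0 \<le> x \<Longrightarrow> dual_apply g x = q x"
proof -
  have q_0: "q 0 = 0" using q_add[of 0 0] by simp
  have q_scale: "q (a *\<^sub>R x) = a * q x" if "0 \<le> a" "0 \<le> x" for a x
  proof (cases "a = 0")
    case False
    then have a: "0 < a" using that by simp
    \<comment> \<open>The scaling hypothesis for the factor \<open>inverse a\<close> yields the
      reverse inequality.\<close>
    have "q (inverse a *\<^sub>R (a *\<^sub>R x)) \<le> inverse a * q (a *\<^sub>R x)"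
      using a that by (intro q_scale_le scaleR_nonneg_nonneg) auto
    then have "a * q x \<le> q (a *\<^sub>R x)" using a by (simp add: field_simps)
    then show ?thesis using q_scale_le[OF a that(2)] by simp
  qed (simp add: q_0)
  define P where "P x = q (pprt x) - q (pprt (- x))" for x
  have decomp: "x = pprt x - pprt (- x)" for x :: 'a using prts[of x] by (simp add: pprt_neg)
  \<comment> \<open>Additivity of \<open>q\<close> makes the value independent of the splitting into
    a difference of positive vectors, so linearity of \<open>P\<close> follows from convenient
    splittings.\<close>
  have P_diff: "P (u - v) = q u - q v" if uv: "0 \<le> u" "0 \<le> v" for u v
  proof -
    have "pprt (u - v) + v = pprt (- (u - v)) + u"
      using decomp[of "u - v"] by (simp add: algebra_simps)
    then have "q (pprt (u - v)) + q v = q (pprt (- (u - v))) + q u"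
      by (metis q_add uv zero_le_pprt)
    then show ?thesis by (simp add: P_def)
  qed
  have P_pos: "P x = q x" if "0 \<le> x" for x
    using P_diff[of x 0] that by (simp add: q_0)
  have P_add: "P (x + y) = P x + P y" for x y
  proof -
    have "x + y = (pprt x + pprt y) - (pprt (- x) + pprt (- y))"
      by (subst decomp[of x], subst decomp[of y]) (simp only: algebra_simps)
    then have "P (x + y) = q (pprt x + pprt y) - q (pprt (- x) + pprt (- y))"
      by (metis P_diff add_nonneg_nonneg zero_le_pprt)
    then show ?thesis by (simp add: q_add P_def)
  qed
  have P_minus: "P (- x) = - P x" for x by (simp add: P_def)
  have P_scale_pos: "P (a *\<^sub>R x) = a * P x" if "0 \<le> a" for a x
  proof -
    have "a *\<^sub>R x = a *\<^sub>R pprt x - a *\<^sub>R pprt (- x)"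
      by (metis decomp scaleR_diff_right)
    then have "P (a *\<^sub>R x) = q (a *\<^sub>R pprt x) - q (a *\<^sub>R pprt (- x))"
      using that by (metis P_diff scaleR_nonneg_nonneg zero_le_pprt)
    then show ?thesis using that by (simp add: q_scale P_def right_diff_distrib)
  qed
  have P_scale: "P (a *\<^sub>R x) = a *\<^sub>R P x" for a x
  proof (cases "0 \<le> a")
    case False
    then have "P ((- a) *\<^sub>R x) = (- a) * P x" by (intro P_scale_pos) simp
    then show ?thesis by (simp add: P_minus)
  qed (simp add: P_scale_pos)
  have P_bound: "norm (P x) \<le> norm x * C" for x
  proof -
    have le: "q (pprt x) \<le> C * norm x" for x
    proof -
      have "norm (pprt x) \<le> norm \<bar>x\<bar>" by (intro norm_mono_pos) (auto simp: abs_prts)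
      then have "C * norm (pprt x) \<le> C * norm x" using C by (intro mult_left_mono) auto
      then show ?thesis using q_bound[of "pprt x"] by simp
    qed
    have "0 \<le> q (pprt x)" "0 \<le> q (pprt (- x))" by (auto intro: q_nonneg)
    then show ?thesis using le[of x] le[of "- x"] by (simp add: P_def abs_le_iff mult.commute)
  qed
  have "bounded_linear P"
    by (rule bounded_linear_intro[OF P_add P_scale P_bound])
  then have "dual_apply (dual_of_blinfun (Blinfun P)) x = P x" for x
    by (simp add: dual_apply.rep_eq dual_of_blinfun_inverse bounded_linear_Blinfun_apply)
  then show thesis using that[of "dual_of_blinfun (Blinfun P)"] P_pos by simp
qed

text \<open>The truncations \<open>inf x (k u)\<close> increase, as \<open>k \<rightarrow> \<infinity>\<close>, to the component of \<open>x\<close> in the band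
  generated by \<open>u\<close>; taking the supremum after applying \<open>f\<close> avoids any need for that component
  to exist in the lattice.\<close>

lemma band_restriction:
  fixes f :: "'a::banach_lattice dual"
  assumes f: "0 \<le> f" and u: "0 \<le> u"
  obtains g where "0 \<le> g" "g \<le> f"
    "\<And>x. 0 \<le> x \<Longrightarrow> dual_apply g x = (SUP k\<in>{0..}. dual_apply f (inf x (k *\<^sub>R u)))"
proof -
  define q where "q x = (SUP k\<in>{0..}. dual_apply f (inf x (k *\<^sub>R u)))" for x
  have ku: "0 \<le> k *\<^sub>R u" if "0 \<le> k" for k :: real using that u by (intro scaleR_nonneg_nonneg)
  have bdd: "bdd_above ((\<lambda>k. dual_apply f (inf x (k *\<^sub>R u))) ` {0..})" for x
    by (intro bdd_aboveI2[of _ _ "dual_apply f x"] dual_mono f) simp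
  have upper: "dual_apply f (inf x (k *\<^sub>R u)) \<le> q x" if "0 \<le> k" for x k
    unfolding q_def using that by (intro cSUP_upper bdd) auto
  have least: "q x \<le> c" if "\<And>k. 0 \<le> k \<Longrightarrow> dual_apply f (inf x (k *\<^sub>R u)) \<le> c" for x c
    unfolding q_def using that by (intro cSUP_least) auto
  have q_le: "q x \<le> dual_apply f x" for x by (intro least dual_mono f) simp
  have q_nonneg: "0 \<le> q x" if "0 \<le> x" for x
    using upper[of 0 x] that by (simp add: inf_absorb2 dual_apply_zero_right)
  obtain g :: "'a dual" where g: "\<And>x. 0 \<le> x \<Longrightarrow> dual_apply g x = q x"
  proof (rule cone_functional_extension[of q "norm f"])
    fix x y :: 'a assume xy: "0 \<le> x" "0 \<le> y"
    show "q (x + y) = q x + q y"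
    proof (rule antisym)
      show "q (x + y) \<le> q x + q y"
      proof (rule least)
        fix k :: real assume k: "0 \<le> k"
        have "dual_apply f (inf (x + y) (k *\<^sub>R u))
            \<le> dual_apply f (inf x (k *\<^sub>R u) + inf y (k *\<^sub>R u))"
          by (intro dual_mono f inf_add_le xy ku k)
        then show "dual_apply f (inf (x + y) (k *\<^sub>R u)) \<le> q x + q y"
          using upper[OF k, of x] upper[OF k, of y] by (simp add: dual_apply_add_right)
      qed
      have "dual_apply f (inf x (k *\<^sub>R u)) \<le> q (x + y) - q y" if k: "0 \<le> k" for k
      proof -
        have "q y \<le> q (x + y) - dual_apply f (inf x (k *\<^sub>R u))"
        proof (rule least)
          fix j :: real assume j: "0 \<le> j"
          \<comment> \<open>Truncation levels add up, which makes the supremum over all levels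
            superadditive.\<close>
          have "inf x (k *\<^sub>R u) + inf y (j *\<^sub>R u) \<le> inf (x + y) ((k + j) *\<^sub>R u)"
            by (simp add: scaleR_add_left add_mono)
          then have "dual_apply f (inf x (k *\<^sub>R u) + inf y (j *\<^sub>R u)) \<le> q (x + y)"
            using upper[of "k + j" "x + y"] dual_mono[OF f] j k
            by (meson add_nonneg_nonneg order_trans)
          then show "dual_apply f (inf y (j *\<^sub>R u)) \<le> q (x + y) - dual_apply f (inf x (k *\<^sub>R u))"
            by (simp add: dual_apply_add_right)
        qed
        then show ?thesis by simp
      qed
      then have "q x \<le> q (x + y) - q y" by (rule least)
      then show "q x + q y \<le> q (x + y)" by simp
    qed
  next
    fix a :: real and x :: 'a assume a: "0 < a" and x: "0 \<le> x"
    show "q (a *\<^sub>R x) \<le> a * q x"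
    proof (rule least)
      fix k :: real assume k: "0 \<le> k"
      let ?w = "inf (a *\<^sub>R x) (k *\<^sub>R u)"
      \<comment> \<open>Rescaling by \<open>inverse a\<close> only changes the truncation level,
        from \<open>k\<close> to \<open>inverse a * k\<close>.\<close>
      have "inverse a *\<^sub>R ?w \<le> inverse a *\<^sub>R (a *\<^sub>R x)" "inverse a *\<^sub>R ?w \<le> inverse a *\<^sub>R (k *\<^sub>R u)"
        using a by (intro scaleR_left_mono; simp)+
      then have "inverse a *\<^sub>R ?w \<le> inf x ((inverse a * k) *\<^sub>R u)" using a by simp
      then have "dual_apply f (inverse a *\<^sub>R ?w) \<le> q x"
        using upper[of "inverse a * k" x] dual_mono[OF f] a k
        by (meson mult_nonneg_nonneg less_imp_le positive_imp_inverse_positive order_trans)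
      then show "dual_apply f ?w \<le> a * q x"
        using a by (simp add: dual_apply_scaleR_right field_simps)
    qed
  next
    show "q x \<le> norm f * norm x" if "0 \<le> x" for x
      using q_le[of x] dual_apply_bound[of f x] by simp
  qed (auto intro: q_nonneg)
  show thesis
    by (rule that[of g])
      (simp_all add: less_eq_dual_def g q_nonneg q_le dual_apply_zero_left flip: q_def)
qed

text \<open>The pointwise infimum over \<open>D\<close> on the cone is itself given by a functional;
  being a lower bound of \<open>D\<close>, it is at most \<open>0\<close>. Decrease to
  \<open>0\<close> in the dual order is thus pointwise decrease to \<open>0\<close> on the
  cone.\<close>

lemma dual_directed_inf:
  fixes D :: "'a::banach_lattice dual set"
  assumes D: "D \<noteq> {}" "\<And>f g. f \<in> D \<Longrightarrow> g \<in> D \<Longrightarrow> \<exists>h\<in>D. h \<le> f \<and> h \<le> g"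
      "\<And>f. f \<in> D \<Longrightarrow> 0 \<le> f" "\<And>l. (\<And>f. f \<in> D \<Longrightarrow> l \<le> f) \<Longrightarrow> l \<le> 0"
    and x: "0 \<le> x" and e: "0 < e"
  obtains f where "f \<in> D" "dual_apply f x < e"
proof -
  define q where "q x = (INF f\<in>D. dual_apply f x)" for x
  have lower: "q x \<le> dual_apply f x" if "0 \<le> x" "f \<in> D" for x f
    unfolding q_def using that by (intro cINF_lower bdd_belowI2[of _ 0] dual_nonneg D(3)) auto
  have greatest: "c \<le> q x" if "\<And>f. f \<in> D \<Longrightarrow> c \<le> dual_apply f x" for x c
    unfolding q_def using that D(1) by (intro cINF_greatest) auto
  obtain f0 where f0: "f0 \<in> D" using D(1) by blast
  obtain g :: "'a dual" where g: "\<And>x. 0 \<le> x \<Longrightarrow> dual_apply g x = q x"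
  proof (rule cone_functional_extension[of q "norm f0"])
    fix x y :: 'a assume xy: "0 \<le> x" "0 \<le> y"
    show "q (x + y) = q x + q y"
    proof (rule antisym)
      have "q (x + y) - q y \<le> dual_apply f x" if f: "f \<in> D" for f
      proof -
        have "q (x + y) - dual_apply f x \<le> q y"
        proof (rule greatest)
          fix h assume h: "h \<in> D"
          \<comment> \<open>Directedness enters here: a common \<open>k\<close> below
            \<open>f\<close> and \<open>h\<close> merges two independent infima into one value at
            \<open>x + y\<close>.\<close>
          obtain k where k: "k \<in> D" "k \<le> f" "k \<le> h" using D(2)[OF f h] by blast
          have "q (x + y) \<le> dual_apply k (x + y)" using xy k by (intro lower) auto
          then show "q (x + y) - dual_apply f x \<le> dual_apply h y"
            using dual_le[OF k(2) xy(1)] dual_le[OF k(3) xy(2)] by (simp add: dual_apply_add_right)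
        qed
        then show ?thesis by simp
      qed
      then have "q (x + y) - q y \<le> q x" by (rule greatest)
      then show "q (x + y) \<le> q x + q y" by simp
      show "q x + q y \<le> q (x + y)"
        using lower[OF xy(1)] lower[OF xy(2)]
        by (intro greatest) (simp add: dual_apply_add_right add_mono)
    qed
  next
    fix a :: real and x :: 'a assume a: "0 < a" and x: "0 \<le> x"
    have "inverse a * q (a *\<^sub>R x) \<le> q x"
    proof (rule greatest)
      fix f assume "f \<in> D"
      then have "q (a *\<^sub>R x) \<le> dual_apply f (a *\<^sub>R x)"
        using a x by (intro lower scaleR_nonneg_nonneg) auto
      then show "inverse a * q (a *\<^sub>R x) \<le> dual_apply f x"
        using a by (simp add: dual_apply_scaleR_right field_simps)
    qed
    then show "q (a *\<^sub>R x) \<le> a * q x" using a by (simp add: field_simps)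
  next
    show "0 \<le> q x" if "0 \<le> x" for x using that by (intro greatest dual_nonneg D(3))
    show "q x \<le> norm f0 * norm x" if "0 \<le> x" for x
      using lower[OF that f0] dual_apply_bound[of f0 x] by simp
  qed auto
  have "g \<le> f" if "f \<in> D" for f using that by (simp add: less_eq_dual_def g lower)
  then have "g \<le> 0" by (rule D(4))
  then have "q x \<le> 0" using x by (simp add: less_eq_dual_def g dual_apply_zero_left)
  then have "\<exists>f\<in>D. dual_apply f x < e" using greatest[of e x] e by force
  then show thesis using that by blast
qed

text \<open>For positive \<open>f\<close> the bound
  \<open>\<bar>dual_apply f x\<bar> \<le> dual_apply f \<bar>x\<bar>\<close> shows that positive
  vectors of the unit ball determine the norm.\<close>

lemma dual_norm_attain:
  fixes f :: "'a::banach_lattice dual"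
  assumes f: "0 \<le> f" and c: "0 \<le> c" "c < norm f"
  obtains x where "0 \<le> x" "norm x \<le> 1" "c < dual_apply f x"
proof -
  have "norm f \<le> c" if small: "\<And>x. 0 \<le> x \<Longrightarrow> norm x \<le> 1 \<Longrightarrow> dual_apply f x \<le> c"
  proof (rule dual_norm_le[OF c(1)])
    fix x :: 'a
    have "dual_apply f \<bar>x\<bar> \<le> c * norm x"
    proof (cases "x = 0")
      case False
      have "dual_apply f (inverse (norm x) *\<^sub>R \<bar>x\<bar>) \<le> c"
        using False by (intro small scaleR_nonneg_nonneg) auto
      then show ?thesis using False by (simp add: dual_apply_scaleR_right field_simps)
    qed (simp add: dual_apply_zero_right)
    then show "\<bar>dual_apply f x\<bar> \<le> c * norm x"
      using dual_apply_le_abs[of f x] f by simp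
  qed
  then show thesis using that c by (meson linorder_not_le)
qed

section \<open>The equivalences\<close>

text \<open>The hypothesis \<open>null\<close> is what (1) provides for the order interval
  \<open>{0..f}\<close>; it is applied to the restrictions of \<open>f\<close> to the bands of the
  \<open>x n\<close>.\<close>

lemma disjoint_dual_null_imp_disjoint_null:
  fixes f :: "'a::banach_lattice dual" and x :: "nat \<Rightarrow> 'a"
  assumes null: "\<And>g :: nat \<Rightarrow> 'a dual. disjoint_seq g \<Longrightarrow> (\<And>n. \<bar>g n\<bar> \<le> f) \<Longrightarrow>
      (\<lambda>n. norm (g n)) \<longlonglongrightarrow> 0"
    and f: "0 \<le> f" and x: "disjoint_seq x" "\<And>n. norm (x n) \<le> 1"
  shows "(\<lambda>n. dual_apply f \<bar>x n\<bar>) \<longlonglongrightarrow> 0"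
proof -
  have "\<exists>g. 0 \<le> g \<and> g \<le> f \<and> (\<forall>y\<ge>0. dual_apply g y =
      (SUP k\<in>{0..}. dual_apply f (inf y (k *\<^sub>R \<bar>x n\<bar>))))" for n
    by (rule band_restriction[OF f, of "\<bar>x n\<bar>"]) auto
  then obtain g where g: "\<And>n. 0 \<le> g n" "\<And>n. g n \<le> f"
    "\<And>n y. 0 \<le> y \<Longrightarrow> dual_apply (g n) y =
      (SUP k\<in>{0..}. dual_apply f (inf y (k *\<^sub>R \<bar>x n\<bar>)))"
    by metis
  have bdd: "bdd_above ((\<lambda>k. dual_apply f (inf y (k *\<^sub>R \<bar>x n\<bar>))) ` {0..})" for y n
    by (intro bdd_aboveI2[of _ _ "dual_apply f y"] dual_mono f) simp
  have upper: "dual_apply f (inf y (k *\<^sub>R \<bar>x n\<bar>)) \<le> dual_apply (g n) y" if "0 \<le> k" "0 \<le> y" for y k n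
    unfolding g(3)[OF that(2)] using that by (intro cSUP_upper bdd) auto
  have zero: "dual_apply (g n) \<bar>x m\<bar> = 0" if "m \<noteq> n" for m n
  proof -
    have "inf \<bar>x m\<bar> (k *\<^sub>R \<bar>x n\<bar>) = 0" if k: "0 \<le> k" for k
    proof -
      \<comment> \<open>The factor \<open>1 / (k + 1)\<close> is at most \<open>1\<close> and turns
        \<open>k\<close> into \<open>k / (k + 1)\<close>, so the scaled \<open>?w\<close> lies below
        both moduli, also when \<open>k = 0\<close>.\<close>
      let ?w = "inf \<bar>x m\<bar> (k *\<^sub>R \<bar>x n\<bar>)" and ?b = "1 / (k + 1)"
      have w: "0 \<le> ?w" using k by (auto intro: scaleR_nonneg_nonneg)
      have "?b *\<^sub>R ?w \<le> 1 *\<^sub>R ?w" using k w by (intro scaleR_right_mono) auto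
      then have "?b *\<^sub>R ?w \<le> \<bar>x m\<bar>" using order_trans by fastforce
      moreover have "?b *\<^sub>R ?w \<le> \<bar>x n\<bar>"
      proof -
        have "?b *\<^sub>R ?w \<le> ?b *\<^sub>R (k *\<^sub>R \<bar>x n\<bar>)" using k by (intro scaleR_left_mono) auto
        also have "\<dots> = (k / (k + 1)) *\<^sub>R \<bar>x n\<bar>" by simp
        also have "\<dots> \<le> 1 *\<^sub>R \<bar>x n\<bar>" using k by (intro scaleR_right_mono) auto
        finally show ?thesis by simp
      qed
      ultimately have "?b *\<^sub>R ?w \<le> inf \<bar>x m\<bar> \<bar>x n\<bar>" by simp
      then have "?b *\<^sub>R ?w \<le> 0" using x(1) \<open>m \<noteq> n\<close> unfolding disjoint_seq_def by metis
      moreover have "0 \<le> ?b *\<^sub>R ?w" using k w by (intro scaleR_nonneg_nonneg) auto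
      ultimately have "?b *\<^sub>R ?w = 0" by (rule antisym)
      then show ?thesis using k by auto
    qed
    then show ?thesis by (simp add: g(3) dual_apply_zero_right)
  qed
  have "disjoint_seq g"
    unfolding disjoint_seq_def
  proof (intro allI impI)
    fix m n :: nat assume mn: "m \<noteq> n"
    define h where "h = inf (g m) (g n)"
    have h: "0 \<le> h" "h \<le> g m" "h \<le> g n" using g by (auto simp: h_def)
    \<comment> \<open>Split \<open>y\<close> at a truncation \<open>?w\<close> for which
      \<open>f\<close> nearly reaches the value of \<open>g m\<close> at \<open>y\<close>. On
      \<open>y - ?w\<close> the functional \<open>h \<le> g m\<close> is below \<open>e\<close>; on
      \<open>?w\<close>, which lies below a multiple of \<open>\<bar>x m\<bar>\<close>, it is
      bounded by \<open>g n\<close>, which vanishes there.\<close>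
    have "dual_apply h y \<le> 0" if y: "0 \<le> y" for y
    proof (rule field_le_epsilon)
      fix e :: real assume "e > 0"
      then have "dual_apply (g m) y - e < (SUP k\<in>{0..}. dual_apply f (inf y (k *\<^sub>R \<bar>x m\<bar>)))"
        using g(3)[OF y] by simp
      then obtain k where k: "0 \<le> k" "dual_apply (g m) y - e < dual_apply f (inf y (k *\<^sub>R \<bar>x m\<bar>))"
        using bdd by (subst (asm) less_cSUP_iff) auto
      let ?w = "inf y (k *\<^sub>R \<bar>x m\<bar>)"
      have w: "0 \<le> ?w" using y k by (auto intro: scaleR_nonneg_nonneg)
      have "dual_apply f ?w \<le> dual_apply (g m) ?w"
        using upper[OF k(1) w, of m] by (simp add: inf.absorb1)
      moreover have "dual_apply h (y - ?w) \<le> dual_apply (g m) (y - ?w)"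
        by (intro dual_le h) (simp del: diff_inf_eq_sup)
      moreover have "dual_apply h ?w \<le> 0"
      proof -
        have "dual_apply h ?w \<le> dual_apply (g n) ?w" by (intro dual_le h w)
        also have "\<dots> \<le> dual_apply (g n) (k *\<^sub>R \<bar>x m\<bar>)" by (intro dual_mono g) simp
        finally show ?thesis using zero[OF mn] by (simp add: dual_apply_scaleR_right)
      qed
      ultimately show "dual_apply h y \<le> 0 + e" using k(2) unfolding dual_apply_diff_right by linarith
    qed
    then have "h \<le> 0" by (simp add: less_eq_dual_def dual_apply_zero_left)
    then have "h = 0" using h(1) by simp
    then show "inf \<bar>g m\<bar> \<bar>g n\<bar> = 0" using g(1) by (simp add: h_def)
  qed
  moreover have "\<bar>g n\<bar> \<le> f" for n using g by simp
  ultimately have lim: "(\<lambda>n. norm (g n)) \<longlonglongrightarrow> 0" by (rule null)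
  have "\<bar>dual_apply f \<bar>x n\<bar>\<bar> \<le> norm (g n)" for n
  proof -
    \<comment> \<open>Truncation at level \<open>1\<close> leaves \<open>\<bar>x n\<bar>\<close>
      unchanged.\<close>
    have "dual_apply f \<bar>x n\<bar> \<le> dual_apply (g n) \<bar>x n\<bar>" using upper[of 1 "\<bar>x n\<bar>" n] by simp
    also have "\<dots> \<le> norm (g n) * norm \<bar>x n\<bar>" using dual_apply_bound[of "g n" "\<bar>x n\<bar>"] by simp
    also have "\<dots> \<le> norm (g n)" using x(2)[of n] by (simp add: mult_left_le)
    finally show ?thesis using dual_nonneg[OF f, of "\<bar>x n\<bar>"] by simp
  qed
  then show ?thesis by (intro Lim_null_comparison[OF _ lim]) simp
qed

section \<open>Order continuity of the dual norm from disjoint vectors\<close>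

lemma disjoint_null_imp_order_continuous_norm:
  assumes null: "\<And>(f :: nat \<Rightarrow> 'a::banach_lattice dual) x. order_bounded (range f) \<Longrightarrow>
      disjoint_seq x \<Longrightarrow> range x \<subseteq> cball 0 1 \<Longrightarrow> (\<lambda>n. dual_apply (f n) (x n)) \<longlonglongrightarrow> 0"
  shows "order_continuous_norm TYPE('a dual)"
  unfolding order_continuous_norm_iff
proof (intro allI impI, elim conjE, rule ccontr)
  fix D :: "'a dual set" and e :: real
  assume D: "D \<noteq> {}" "\<forall>f\<in>D. \<forall>g\<in>D. \<exists>h\<in>D. h \<le> f \<and> h \<le> g" "\<forall>f\<in>D. 0 \<le> f"
    "\<forall>l. (\<forall>f\<in>D. l \<le> f) \<longrightarrow> l \<le> 0" and e: "0 < e" and "\<not> (\<exists>f\<in>D. norm f < e)"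
  then have norm_ge: "e \<le> norm f" if "f \<in> D" for f using that by force
  have "\<forall>f\<in>D. \<exists>x. 0 \<le> x \<and> norm x \<le> 1 \<and> e / 2 < dual_apply f x"
  proof
    fix f assume "f \<in> D"
    then have "0 \<le> f" "0 \<le> e / 2" "e / 2 < norm f" using norm_ge[of f] D(3) e by auto
    then show "\<exists>x. 0 \<le> x \<and> norm x \<le> 1 \<and> e / 2 < dual_apply f x"
      by (rule dual_norm_attain) blast
  qed
  then obtain X where X: "\<And>f. f \<in> D \<Longrightarrow> 0 \<le> X f" "\<And>f. f \<in> D \<Longrightarrow> norm (X f) \<le> 1"
    "\<And>f. f \<in> D \<Longrightarrow> e / 2 < dual_apply f (X f)"
    by (drule_tac bchoice) blast
  \<comment> \<open>\<open>dual_directed_inf\<close> gives a functional small at \<open>x\<close>;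
    directedness then finds one that is also below \<open>f\<close>.\<close>
  have small: "\<exists>h\<in>D. h \<le> f \<and> dual_apply h x < c" if f: "f \<in> D" and x: "0 \<le> x" and c: "0 < c" for f x c
  proof -
    obtain g where g: "g \<in> D" "dual_apply g x < c"
    proof (rule dual_directed_inf[of D x c])
      show "\<exists>h\<in>D. h \<le> f \<and> h \<le> g" if "f \<in> D" "g \<in> D" for f g
        using D(2) that by simp
      show "l \<le> 0" if "\<And>f. f \<in> D \<Longrightarrow> l \<le> f" for l using D(4) that by simp
    qed (use D(1,3) x c in auto)
    obtain h where "h \<in> D" "h \<le> f" "h \<le> g" using D(2) f g(1) by blast
    then show ?thesis using g(2) dual_le[of h g x] x by force
  qed
  \<comment> \<open>A state holds the current functional and the sum of the vectors chosen before
    it. The factor \<open>4 ^ Suc n\<close> anticipates the weight with which that sum is subtracted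
    at index \<open>Suc n\<close> when the vectors are made disjoint.\<close>
  define Q where "Q n p p' \<longleftrightarrow> snd p' = snd p + X (fst p) \<and> fst p' \<le> fst p \<and>
      4 ^ Suc n * dual_apply (fst p') (snd p') \<le> e / 4" for n :: nat and p p' :: "'a dual \<times> 'a"
  have "\<exists>p. \<forall>n. (fst (p n) \<in> D \<and> 0 \<le> snd (p n) \<and> (n = 0 \<longrightarrow> snd (p n) = 0)) \<and> Q n (p n) (p (Suc n))"
  proof (rule dependent_nat_choice)
    show "\<exists>p::'a dual \<times> 'a. fst p \<in> D \<and> 0 \<le> snd p \<and> (0 = (0::nat) \<longrightarrow> snd p = 0)" using D(1) by force
    fix p :: "'a dual \<times> 'a" and n :: nat
    assume p: "fst p \<in> D \<and> 0 \<le> snd p \<and> (n = 0 \<longrightarrow> snd p = 0)"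
    have s: "0 \<le> snd p + X (fst p)" using p X by simp
    obtain h where "h \<in> D" "h \<le> fst p" "dual_apply h (snd p + X (fst p)) < e / 4 / 4 ^ Suc n"
      using small[of "fst p" _ "e / 4 / 4 ^ Suc n", OF _ s] p e by auto
    then show "\<exists>p'. (fst p' \<in> D \<and> 0 \<le> snd p' \<and> (Suc n = 0 \<longrightarrow> snd p' = 0)) \<and> Q n p p'"
      using s by (intro exI[of _ "(h, snd p + X (fst p))"]) (auto simp: Q_def field_simps)
  qed
  then obtain p where p: "\<And>n. fst (p n) \<in> D" "snd (p 0) = 0" "\<And>n. Q n (p n) (p (Suc n))"
    by blast
  define f where "f n = fst (p n)" for n
  define x where "x n = X (f n)" for n
  have fD: "f n \<in> D" for n by (simp add: f_def p)
  have f0: "0 \<le> f n" for n using fD D(3) by blast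
  have x: "0 \<le> x n" "norm (x n) \<le> 1" "e / 2 < dual_apply (f n) (x n)" for n
    using X[OF fD[of n]] by (auto simp: x_def)
  have sum: "snd (p n) = (\<Sum>i<n. x i)" for n
    by (induction n) (use p in \<open>auto simp: Q_def x_def f_def\<close>)
  have fdec: "f n \<le> f 0" for n
  proof (induction n)
    case (Suc n)
    then show ?case using p(3)[of n] order_trans unfolding Q_def f_def by blast
  qed simp
  have fsum: "4 ^ n * dual_apply (f n) (\<Sum>i<n. x i) \<le> e / 4" for n
  proof (cases n)
    case 0
    then show ?thesis using e by (simp add: dual_apply_zero_right)
  next
    case (Suc m)
    show ?thesis using p(3)[of m] unfolding Q_def f_def sum[symmetric] Suc by (elim conjE)
  qed
  \<comment> \<open>The weights \<open>(1/2)^n\<close> make the series of unit ball vectors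
    converge; its sum is the common bound \<open>z\<close> that \<open>disjoint_pprt\<close> asks
    for.\<close>
  have summ: "summable (\<lambda>n. (1/2)^n *\<^sub>R x n)"
  proof (rule summable_comparison_test'[of "\<lambda>n. (1/2::real)^n" 0])
    show "norm ((1/2)^n *\<^sub>R x n) \<le> (1/2)^n" for n
      using x(2)[of n] by (simp add: mult_left_le)
  qed (simp add: summable_geometric)
  define z where "z = (\<Sum>n. (1/2)^n *\<^sub>R x n)"
  have z: "(1/2)^n *\<^sub>R x n \<le> z" for n
  proof (rule lim_ge)
    show "(\<lambda>N. \<Sum>i<N. (1/2)^i *\<^sub>R x i) \<longlonglongrightarrow> z"
      unfolding z_def by (rule summable_LIMSEQ[OF summ])
    show "(1/2)^n *\<^sub>R x n \<le> (\<Sum>i<N. (1/2)^i *\<^sub>R x i)" if "N \<ge> Suc n" for N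
      using that x(1)
      sum_mono2[of "{..<N}" "{n}" "\<lambda>i. (1/2)^i *\<^sub>R x i"]
      by (auto simp: scaleR_nonneg_nonneg)
  qed
  have z0: "0 \<le> z" using x(1)[of 0] z[of 0] by simp
  define y where "y n = pprt (x n - 4^n *\<^sub>R (\<Sum>i<n. x i) - (1/2)^n *\<^sub>R z)" for n
  have y_le: "y n \<le> x n" for n
  proof -
    have "0 \<le> 4^n *\<^sub>R (\<Sum>i<n. x i)" "0 \<le> (1/2)^n *\<^sub>R z"
      using x z0 by (auto intro!: scaleR_nonneg_nonneg sum_nonneg)
    then have "x n - 4^n *\<^sub>R (\<Sum>i<n. x i) - (1/2)^n *\<^sub>R z \<le> x n - 0 - 0"
      by (intro diff_mono) auto
    then show ?thesis using x by (simp add: y_def pprt_def)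
  qed
  have "norm (y n) \<le> 1" for n
    using norm_mono_pos[OF _ y_le[of n]] x(2)[of n] by (simp add: y_def)
  then have "range y \<subseteq> cball 0 1" by auto
  moreover have "disjoint_seq y"
    unfolding y_def by (rule disjoint_pprt[OF x(1) z])
  moreover have "order_bounded (range f)"
    unfolding order_bounded_def using f0 fdec by (intro exI[of _ 0] exI[of _ "f 0"]) auto
  ultimately have lim: "(\<lambda>n. dual_apply (f n) (y n)) \<longlonglongrightarrow> 0" by (intro null)
  \<comment> \<open>Of the value above \<open>e / 2\<close> at \<open>x n\<close>, the subtracted
    sum costs at most \<open>e / 4\<close> by \<open>fsum\<close>, and the \<open>z\<close> term
    costs at most \<open>(1/2)^n * dual_apply (f 0) z\<close>, which tends to
    \<open>0\<close>.\<close>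
  have ge: "e / 4 - (1/2)^n * dual_apply (f 0) z \<le> dual_apply (f n) (y n)" for n
  proof -
    have "dual_apply (f n) (x n - 4^n *\<^sub>R (\<Sum>i<n. x i) - (1/2)^n *\<^sub>R z) \<le> dual_apply (f n) (y n)"
      by (intro dual_mono f0) (simp add: y_def pprt_def)
    moreover have "(1/2)^n * dual_apply (f n) z \<le> (1/2)^n * dual_apply (f 0) z"
      using dual_le[OF fdec z0] by (intro mult_left_mono) auto
    ultimately show ?thesis
      using fsum[of n] x(3)[of n]
      unfolding dual_apply_diff_right dual_apply_scaleR_right by linarith
  qed
  have "(\<lambda>n. e / 4 - (1/2)^n * dual_apply (f 0) z) \<longlonglongrightarrow> e / 4 - 0 * dual_apply (f 0) z"
    by (intro tendsto_intros) auto
  then have "e / 4 - 0 * dual_apply (f 0) z \<le> 0"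
    using lim ge by (intro LIMSEQ_le) auto
  then show False using e by simp
qed

section \<open>The cycle of implications\<close>

theorem corollary2p2:
  shows "(order_L_weakly_compact (id_blinfun :: 'e::banach_lattice dual \<Rightarrow>\<^sub>L 'e dual)
            \<longleftrightarrow> order_continuous_norm TYPE('e dual))
       \<and> (order_continuous_norm TYPE('e dual)
            \<longleftrightarrow> (\<forall>(f :: nat \<Rightarrow> 'e dual) (x :: nat \<Rightarrow> 'e).
                   order_bounded (range f) \<and> disjoint_seq x \<and> range x \<subseteq> cball 0 1 \<longrightarrow>
                   (\<lambda>n. dual_apply (f n) (x n)) \<longlonglongrightarrow> 0))
       \<and> (order_continuous_norm TYPE('e dual)
            \<longleftrightarrow> order_M_weakly_compact (id_blinfun :: 'e \<Rightarrow>\<^sub>L 'e))"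
    (is "(?L \<longleftrightarrow> ?C) \<and> (?C \<longleftrightarrow> ?N) \<and> (?C \<longleftrightarrow> ?M)")
proof -
  have "?N \<longleftrightarrow> ?M" unfolding order_M_weakly_compact_def by auto
  moreover have "?L" if ?C
    unfolding order_L_weakly_compact_def L_weakly_compact_def
  proof (intro allI impI conjI)
    fix f :: "'e dual" assume f: "0 \<le> f"
    then show "blinfun_apply id_blinfun ` {0..f} \<noteq> {}" by auto
    show "bounded (blinfun_apply id_blinfun ` {0..f})"
      by (rule boundedI[of _ "norm f"]) (auto intro: norm_mono_pos)
    fix g :: "nat \<Rightarrow> 'e dual"
    assume g: "disjoint_seq g \<and> range g \<subseteq> solid hull blinfun_apply id_blinfun ` {0..f}"
    have "\<bar>g n\<bar> \<le> f" for n
    proof -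
      have "g n \<in> solid hull blinfun_apply id_blinfun ` {0..f}" using g by blast
      then show ?thesis by (auto simp: solid_hull intro: order_trans)
    qed
    then show "(\<lambda>n. norm (g n)) \<longlonglongrightarrow> 0"
      using order_continuous_norm_disjoint_null[OF \<open>?C\<close>] g by blast
  qed
  moreover have "?N" if ?L
  proof (intro allI impI, elim conjE)
    fix f :: "nat \<Rightarrow> 'e dual" and x :: "nat \<Rightarrow> 'e"
    assume "order_bounded (range f)" and x: "disjoint_seq x" "range x \<subseteq> cball 0 1"
    then obtain a b where "range f \<subseteq> {a..b}" unfolding order_bounded_def by blast
    then have "f n \<in> {a..b}" for n by blast
    then have ab: "a \<le> f n" "f n \<le> b" for n by simp_all
    \<comment> \<open>One positive functional dominating every modulus:
      \<open>f n \<le> \<bar>b\<bar>\<close> and \<open>- f n \<le> \<bar>a\<bar>\<close>, and the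
      sum is above both. This reduces (3) to a single functional.\<close>
    define F where "F = \<bar>a\<bar> + \<bar>b\<bar>"
    have F: "0 \<le> F" by (simp add: F_def)
    have fF: "\<bar>f n\<bar> \<le> F" for n
    proof -
      have "f n \<le> \<bar>b\<bar>" "- f n \<le> \<bar>a\<bar>"
        using order_trans[OF ab(2) abs_ge_self] order_trans[OF _ abs_ge_minus_self, of "- f n" a] ab(1)[of n]
        by simp_all
      then have "f n \<le> F" "- f n \<le> F"
        unfolding F_def by (auto intro: add_increasing add_increasing2)
      then show ?thesis by (simp add: abs_lattice)
    qed
    have "(\<lambda>n. norm (g n)) \<longlonglongrightarrow> 0" if "disjoint_seq g" "\<And>n. \<bar>g n\<bar> \<le> F" for g :: "nat \<Rightarrow> 'e dual"
    proof -
      have "range g \<subseteq> solid hull blinfun_apply id_blinfun ` {0..F}"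
        using that(2) F by (auto simp: solid_hull intro!: bexI[of _ F])
      then show ?thesis
        using \<open>?L\<close> F that(1) by (simp add: order_L_weakly_compact_def L_weakly_compact_def)
    qed
    moreover have "norm (x n) \<le> 1" for n using subsetD[OF x(2), of "x n"] by simp
    ultimately have lim: "(\<lambda>n. dual_apply F \<bar>x n\<bar>) \<longlonglongrightarrow> 0"
      using disjoint_dual_null_imp_disjoint_null F x(1) by blast
    have "\<bar>dual_apply (f n) (x n)\<bar> \<le> dual_apply F \<bar>x n\<bar>" for n
      using dual_apply_le_abs[of "f n" "x n"] dual_le[OF fF, of "\<bar>x n\<bar>" n] by simp
    then show "(\<lambda>n. dual_apply (f n) (x n)) \<longlonglongrightarrow> 0"
      by (intro Lim_null_comparison[OF _ lim]) simp
  qed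
  moreover have "?C" if ?N
    using that by (intro disjoint_null_imp_order_continuous_norm) blast
  ultimately show ?thesis by blast
qed

end
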